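(* For any integers $n>k\ge0$, $$[2k+1]_q\begin{bmatrix}2k\\k\end{bmatrix}_q\sum_{h=0}^{n-1}q^h\begin{bmatrix}h\\k\end{bmatrix}_q^2\equiv0\pmod{[n]_q}$$ in $\mathbb Z[q]$, and hence $$(2k+1)\binom{2k}k\sum_{h=0}^{n-1}\binom hk^2\equiv0\pmod n.$$
   Context: $[m]_q=(1-q^m)/(1-q)$ for $m\in\mathbb Z$; $\begin{bmatrix}m\\0\end{bmatrix}_q=1$ and $\begin{bmatrix}m\\k\end{bmatrix}_q=\prod_{j=0}^{k-1}[m-j]_q/\prod_{j=1}^k[j]_q$ for $k\ge1$ (a polynomial in $\mathbb Z[q]$ for $m,k\in\mathbb N$, equal to $0$ when $m<k$). *)

theory Defs
  imports
    "HOL-Computational_Algebra.Polynomial_Factorial"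
    "HOL-Number_Theory.Cong"
begin

text \<open>
  The indeterminate \<open>q\<close> lives in the fraction field of \<open>\<int>[q]\<close>, so that the quotients
  defining q-integers and q-binomial coefficients, including negative powers of \<open>q\<close>,
  are honest field divisions.
\<close>

definition qvar :: "int poly fract" where
  "qvar = to_fract [:0, 1:]"

definition Zq :: "int poly fract set" where
  "Zq = range to_fract"

definition q_int :: "int \<Rightarrow> int poly fract" where
  "q_int m = (1 - qvar powi m) / (1 - qvar)"

definition q_binomial :: "int \<Rightarrow> nat \<Rightarrow> int poly fract" where
  "q_binomial m k = (\<Prod>j<k. q_int (m - int j)) / (\<Prod>j=1..k. q_int (int j))"

text \<open>
  Congruence in the ring \<open>\<int>[q]\<close>: both sides and the modulus are required to be
  polynomials, and so is the cofactor.
\<close>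

definition Zq_cong :: "int poly fract \<Rightarrow> int poly fract \<Rightarrow> int poly fract \<Rightarrow> bool" where
  "Zq_cong a b m \<longleftrightarrow> a \<in> Zq \<and> b \<in> Zq \<and> m \<in> Zq \<and> (\<exists>c\<in>Zq. a - b = m * c)"

end

theory Submission
  imports Defs
begin

text \<open>
  The \<open>q\<close>-Vandermonde identity linearises the square,
  \<open>[h,k]\<^sup>2 = (\<Sum>j\<le>k. q^(j\<^sup>2) [k,k-j] [k+j,k] [h,k+j])\<close>, and \<open>q^h [h,m]\<close> summed over \<open>h < n\<close>
  gives \<open>q^m [n,m+1] = q^m [n] [n-1,m] / [m+1]\<close>. The denominator \<open>[k+j+1]\<close> that arises for
  \<open>m = k + j\<close> is absorbed by the prefactor, since
  \<open>[2k+1] [2k,k] [k,k-j] = [k+j+1] [2k+1,k-j] [k+j,k]\<close>.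
  All of this holds in every integral domain in which the positive \<open>q\<close>-integers are nonzero, hence
  for the indeterminate of \<open>\<int>[q]\<close> and also for \<open>q = 1\<close> in \<open>\<int>\<close>.
\<close>

section \<open>Division-free q-integers, q-factorials and q-binomials over a commutative
  ring\<close>

definition gauss_int :: "'a::comm_ring_1 \<Rightarrow> nat \<Rightarrow> 'a" where
  "gauss_int q n = (\<Sum>i<n. q ^ i)"

definition gauss_fact :: "'a::comm_ring_1 \<Rightarrow> nat \<Rightarrow> 'a" where
  "gauss_fact q n = (\<Prod>i<n. gauss_int q (Suc i))"

text \<open>Pascal's rule serves as the definition instead of a quotient, so that specialising to
  \<open>q = 1\<close> is legitimate. Agreement with the quotient is
  \<open>q_binomial_of_nat\<close>.\<close>

fun gauss_binomial :: "'a::comm_ring_1 \<Rightarrow> nat \<Rightarrow> nat \<Rightarrow> 'a" where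
  "gauss_binomial q n 0 = 1"
| "gauss_binomial q 0 (Suc k) = 0"
| "gauss_binomial q (Suc n) (Suc k) =
     gauss_binomial q n k + q ^ Suc k * gauss_binomial q n (Suc k)"

lemma gauss_int_0 [simp]: "gauss_int q 0 = 0"
  by (simp add: gauss_int_def)

lemma gauss_int_add: "gauss_int q (m + n) = gauss_int q m + q ^ m * gauss_int q n"
  by (induction n) (simp_all add: gauss_int_def algebra_simps power_add)

lemma gauss_int_1: "gauss_int 1 n = of_nat n"
  by (simp add: gauss_int_def)

lemma gauss_fact_0 [simp]: "gauss_fact q 0 = 1"
  by (simp add: gauss_fact_def)

lemma gauss_fact_Suc: "gauss_fact q (Suc n) = gauss_fact q n * gauss_int q (Suc n)"
  by (simp add: gauss_fact_def)

lemma gauss_binomial_eq_0: "n < k \<Longrightarrow> gauss_binomial q n k = 0"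
  by (induction q n k rule: gauss_binomial.induct) auto

lemma gauss_binomial_self [simp]: "gauss_binomial q n n = 1"
  by (induction n) (simp_all add: gauss_binomial_eq_0)

lemma gauss_binomial_1: "gauss_binomial 1 n k = of_nat (n choose k)"
  by (induction "1 :: 'a" n k rule: gauss_binomial.induct) auto

text \<open>The factorial formula with denominators cleared. The two Pascal summands contribute
  \<open>[k]\<close> and \<open>q^k [m]\<close> times \<open>[k+m-1]!\<close>, and these add up to
  \<open>[k+m]!\<close> by \<open>gauss_int_add\<close>.\<close>

lemma gauss_binomial_fact:
  "gauss_binomial q (k + m) k * gauss_fact q k * gauss_fact q m = gauss_fact q (k + m)"
proof (induction "k + m" arbitrary: k m)
  case 0
  then show ?case by simp
next
  case (Suc n)
  show ?case
  proof (cases k)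
    case 0
    then show ?thesis by simp
  next
    case k: (Suc k')
    show ?thesis
    proof (cases m)
      case 0
      then show ?thesis by simp
    next
      case m: (Suc m')
      have n: "n = k' + m" "n = k + m'"
        using Suc.hyps(2) k m by auto
      have 1: "gauss_binomial q n k' * gauss_fact q k' * gauss_fact q m = gauss_fact q n"
        using Suc.hyps(1)[OF n(1)] n(1) by simp
      have 2: "gauss_binomial q n k * gauss_fact q k * gauss_fact q m' = gauss_fact q n"
        using Suc.hyps(1)[OF n(2)] n(2) by simp
      have "gauss_binomial q (k + m) k * gauss_fact q k * gauss_fact q m
          = (gauss_binomial q n k' + q ^ k * gauss_binomial q n k) * gauss_fact q k * gauss_fact q m"
        using k n(1) by simp
      also have "\<dots> = gauss_int q k * (gauss_binomial q n k' * gauss_fact q k' * gauss_fact q m)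
          + q ^ k * gauss_int q m * (gauss_binomial q n k * gauss_fact q k * gauss_fact q m')"
        unfolding k m gauss_fact_Suc by (simp add: algebra_simps)
      also have "\<dots> = gauss_fact q n * gauss_int q (k + m)"
        unfolding 1 2 gauss_int_add by (simp add: algebra_simps)
      also have "\<dots> = gauss_fact q (k + m)"
        using n(1) k by (simp add: gauss_fact_Suc)
      finally show ?thesis .
    qed
  qed
qed

text \<open>The mirror Pascal rule, whose weight is \<open>q^(n-m)\<close>. Multiplying through by
  \<open>q^m\<close> avoids the subtraction in the exponent and gives exactly the increment needed
  for telescoping in \<open>sum_power_gauss_binomial\<close>.\<close>

lemma gauss_binomial_Pascal':
  "q ^ m * gauss_binomial q (Suc n) (Suc m) =
     q ^ m * gauss_binomial q n (Suc m) + q ^ n * gauss_binomial q n m"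
proof (induction n arbitrary: m)
  case 0
  then show ?case by (cases m) auto
next
  case (Suc n)
  have IH: "q ^ m * (gauss_binomial q n m + q ^ Suc m * gauss_binomial q n (Suc m))
      = q ^ m * gauss_binomial q n (Suc m) + q ^ n * gauss_binomial q n m" for m
    using Suc[of m] by simp
  show ?case
  proof (cases m)
    case 0
    then show ?thesis
      using IH[of 0] by (simp add: algebra_simps)
  next
    case m: (Suc m')
    let ?G = "gauss_binomial q n"
    have "q ^ m * gauss_binomial q (Suc (Suc n)) (Suc m)
        = q * (q ^ m' * (?G m' + q ^ Suc m' * ?G m))
          + q ^ Suc m * (q ^ m * (?G m + q ^ Suc m * ?G (Suc m)))"
      using m by (simp add: algebra_simps)
    also have "\<dots> = q * (q ^ m' * ?G m + q ^ n * ?G m')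
          + q ^ Suc m * (q ^ m * ?G (Suc m) + q ^ n * ?G m)"
      unfolding IH using IH[of m'] m by simp
    also have "\<dots> = q ^ m * gauss_binomial q (Suc n) (Suc m)
          + q ^ Suc n * gauss_binomial q (Suc n) m"
      using m by (simp add: algebra_simps)
    finally show ?thesis .
  qed
qed

lemma sum_power_gauss_binomial:
  "(\<Sum>h<n. q ^ h * gauss_binomial q h m) = q ^ m * gauss_binomial q n (Suc m)"
  by (induction n) (simp_all only: gauss_binomial_Pascal' sum.lessThan_Suc, simp_all)

text \<open>Induction on \<open>n\<close> with Pascal's rule applied to the last factor. The
  subtraction \<open>n - (r - j)\<close> truncates only when \<open>r - j > n\<close>, where that
  factor vanishes.\<close>

lemma gauss_Vandermonde:
  "gauss_binomial q (m + n) r =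
     (\<Sum>j\<le>r. q ^ (j * (n - (r - j))) * gauss_binomial q m j * gauss_binomial q n (r - j))"
proof (induction n arbitrary: r)
  case 0
  have "(\<Sum>j\<le>r. q ^ (j * (0 - (r - j))) * gauss_binomial q m j * gauss_binomial q 0 (r - j))
      = (\<Sum>j\<in>{r}. q ^ (j * (0 - (r - j))) * gauss_binomial q m j * gauss_binomial q 0 (r - j))"
    by (rule sum.mono_neutral_right) (auto simp: gauss_binomial_eq_0)
  then show ?case by simp
next
  case (Suc n)
  show ?case
  proof (cases r)
    case 0
    then show ?thesis by simp
  next
    case r: (Suc s)
    let ?t = "\<lambda>n r j. q ^ (j * (n - (r - j))) * gauss_binomial q m j * gauss_binomial q n (r - j)"
    \<comment> \<open>Since \<open>r - j = Suc (s - j)\<close>, Pascal's rule splits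
      \<open>[n+1,r-j]\<close>. The first part has the exponent of \<open>?t n s j\<close> already;
      the second has the extra power \<open>q^(r-j) * q^j = q^r\<close>.\<close>
    have step: "?t (Suc n) r j = ?t n s j + q ^ r * ?t n r j" if "j \<le> s" for j
    proof -
      have d: "r - j = Suc (s - j)" using that r by simp
      show ?thesis
      proof (cases "r - j \<le> n")
        case True
        then obtain e where e: "n = r - j + e"
          using le_Suc_ex by blast
        have "n - (s - j) = Suc e" "n - (r - j) = e" "r = Suc (s - j) + j"
          using e d that r by simp_all
        then have pow: "q ^ Suc (s - j) * q ^ (j * (n - (s - j))) = q ^ r * q ^ (j * (n - (r - j)))"
          by (simp add: power_add mult_ac)
        have "?t (Suc n) r j - ?t n s j
            = (q ^ Suc (s - j) * q ^ (j * (n - (s - j)))) * gauss_binomial q m j * gauss_binomial q n (r - j)"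
          unfolding d diff_Suc_Suc gauss_binomial.simps by (simp only: ring_distribs mult_ac) simp
        also have "\<dots> = q ^ r * ?t n r j"
          unfolding pow by (simp only: mult_ac)
        finally show ?thesis
          by (simp only: algebra_simps)
      next
        case False
        then show ?thesis
          unfolding d by (simp add: gauss_binomial_eq_0 algebra_simps)
      qed
    qed
    have "gauss_binomial q (m + Suc n) r
        = gauss_binomial q (m + n) s + q ^ r * gauss_binomial q (m + n) r"
      using r by simp
    also have "\<dots> = (\<Sum>j\<le>s. ?t n s j + q ^ r * ?t n r j) + q ^ r * ?t n r r"
      unfolding Suc r sum.atMost_Suc by (simp add: sum.distrib sum_distrib_left distrib_left)
    \<comment> \<open>The top term \<open>j = r\<close> has lower index 0, so Pascal's rule does not
      apply; there \<open>q^r\<close> is absorbed by \<open>q^(r*n)\<close>.\<close>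
    also have "\<dots> = (\<Sum>j\<le>s. ?t (Suc n) r j) + ?t (Suc n) r r"
      using step by (simp add: power_add)
    also have "\<dots> = (\<Sum>j\<le>r. ?t (Suc n) r j)"
      unfolding r by simp
    finally show ?thesis .
  qed
qed

section \<open>Identities by cancelling q-factorials in an integral domain, and the
  divisibility\<close>

context
  fixes q :: "'a::idom"
  assumes gauss_int_nonzero: "\<And>n. n > 0 \<Longrightarrow> gauss_int q n \<noteq> 0"
begin

lemma gauss_fact_nonzero: "gauss_fact q n \<noteq> 0"
  by (induction n) (simp_all add: gauss_fact_Suc gauss_int_nonzero)

text \<open>For \<open>n = Suc k + m\<close> both sides times \<open>[k]! [m]!\<close> equal
  \<open>[n]!\<close>. This ratio of neighbours later matches the quotient definition of
  \<open>q_binomial\<close>.\<close>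

lemma gauss_binomial_step:
  assumes "k \<le> n"
  shows "gauss_int q (Suc k) * gauss_binomial q n (Suc k) = gauss_int q (n - k) * gauss_binomial q n k"
proof (cases "n = k")
  case True
  then show ?thesis by (simp add: gauss_binomial_eq_0)
next
  case False
  then obtain m where n: "n = Suc k + m"
    using assms le_Suc_ex[of "Suc k" n] by auto
  have "(gauss_int q (Suc k) * gauss_binomial q n (Suc k)) * (gauss_fact q k * gauss_fact q m)
      = gauss_fact q n"
    using gauss_binomial_fact[of q "Suc k" m] n by (simp add: gauss_fact_Suc mult_ac)
  moreover have "(gauss_int q (n - k) * gauss_binomial q n k) * (gauss_fact q k * gauss_fact q m)
      = gauss_fact q n"
    using gauss_binomial_fact[of q k "Suc m"] n by (simp add: gauss_fact_Suc mult_ac)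
  ultimately have "(gauss_int q (Suc k) * gauss_binomial q n (Suc k)) * (gauss_fact q k * gauss_fact q m)
      = (gauss_int q (n - k) * gauss_binomial q n k) * (gauss_fact q k * gauss_fact q m)"
    by simp
  then show ?thesis
    unfolding mult_cancel_right using gauss_fact_nonzero by simp
qed

text \<open>By Pascal's rule and \<open>gauss_binomial_step\<close> the left side is
  \<open>[k+1] + q^(k+1) [n-k]\<close> times \<open>[n,k]\<close>, and that sum is
  \<open>[n+1]\<close>.\<close>

lemma gauss_binomial_absorption:
  "gauss_int q (Suc k) * gauss_binomial q (Suc n) (Suc k) = gauss_int q (Suc n) * gauss_binomial q n k"
proof (cases "k \<le> n")
  case True
  have "gauss_int q (Suc n) = gauss_int q (Suc k) + q ^ Suc k * gauss_int q (n - k)"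
    using gauss_int_add[of q "Suc k" "n - k"] True by simp
  moreover have "gauss_int q (Suc k) * gauss_binomial q (Suc n) (Suc k)
      = gauss_int q (Suc k) * gauss_binomial q n k
        + q ^ Suc k * (gauss_int q (Suc k) * gauss_binomial q n (Suc k))"
    by (simp add: algebra_simps)
  ultimately show ?thesis
    unfolding gauss_binomial_step[OF True] by (simp add: algebra_simps)
next
  case False
  then show ?thesis by (simp add: gauss_binomial_eq_0)
qed

text \<open>The q-analogue of counting nested subsets: for \<open>h = k + j + m\<close> both sides
  times \<open>[k]! [j]! [m]!\<close> equal \<open>[h]!\<close>, and otherwise both vanish.\<close>

lemma gauss_binomial_mult:
  "gauss_binomial q h k * gauss_binomial q (h - k) j
     = gauss_binomial q h (k + j) * gauss_binomial q (k + j) k"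
proof (cases "k + j \<le> h")
  case True
  then obtain m where h: "h = k + j + m"
    using le_Suc_ex by blast
  let ?c = "gauss_fact q k * gauss_fact q j * gauss_fact q m"
  have "(gauss_binomial q h k * gauss_binomial q (h - k) j) * ?c
      = gauss_binomial q h k * gauss_fact q k
        * (gauss_binomial q (j + m) j * gauss_fact q j * gauss_fact q m)"
    using h by (simp add: mult_ac)
  also have "\<dots> = gauss_fact q h"
    unfolding gauss_binomial_fact using gauss_binomial_fact[of q k "j + m"] h
    by (simp add: add_ac)
  finally have 1: "(gauss_binomial q h k * gauss_binomial q (h - k) j) * ?c = gauss_fact q h" .
  have "(gauss_binomial q h (k + j) * gauss_binomial q (k + j) k) * ?c
      = gauss_binomial q h (k + j)
        * (gauss_binomial q (k + j) k * gauss_fact q k * gauss_fact q j) * gauss_fact q m"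
    by (simp add: mult_ac)
  also have "\<dots> = gauss_fact q h"
    unfolding gauss_binomial_fact using gauss_binomial_fact[of q "k + j" m] h by simp
  finally have "(gauss_binomial q h k * gauss_binomial q (h - k) j) * ?c
      = (gauss_binomial q h (k + j) * gauss_binomial q (k + j) k) * ?c"
    unfolding 1 ..
  then show ?thesis
    unfolding mult_cancel_right using gauss_fact_nonzero by simp
next
  case False
  then show ?thesis
    by (cases "k \<le> h") (simp_all add: gauss_binomial_eq_0)
qed

text \<open>Only one factor is expanded, by Vandermonde with \<open>h = (h - k) + k\<close>, where
  the exponent \<open>j * (k - (k - j))\<close> is \<open>j^2\<close>. The other factor merges with
  \<open>[h-k,j]\<close>, leaving a single binomial that depends on \<open>h\<close>.\<close>

lemma gauss_binomial_square:
  "(gauss_binomial q h k)\<^sup>2 =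
     (\<Sum>j\<le>k. q ^ j\<^sup>2 * gauss_binomial q k (k - j) * gauss_binomial q (k + j) k
        * gauss_binomial q h (k + j))"
proof (cases "k \<le> h")
  case True
  have "gauss_binomial q h k
      = (\<Sum>j\<le>k. q ^ j\<^sup>2 * gauss_binomial q (h - k) j * gauss_binomial q k (k - j))"
    using gauss_Vandermonde[of q "h - k" k k] True by (simp add: power2_eq_square)
  then have "(gauss_binomial q h k)\<^sup>2
      = (\<Sum>j\<le>k. q ^ j\<^sup>2 * gauss_binomial q k (k - j)
          * (gauss_binomial q h k * gauss_binomial q (h - k) j))"
    by (subst power2_eq_square, subst (2) \<open>gauss_binomial q h k = _\<close>)
      (simp add: sum_distrib_left mult_ac)
  then show ?thesis
    unfolding gauss_binomial_mult by (simp add: mult_ac)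
next
  case False
  then show ?thesis by (simp add: gauss_binomial_eq_0)
qed

text \<open>Both sides times \<open>?c\<close> equal \<open>[2k+1]! [k]!\<close>.\<close>

lemma central_gauss_binomial_mult:
  assumes "j \<le> k"
  shows "gauss_int q (2 * k + 1) * gauss_binomial q (2 * k) k * gauss_binomial q k (k - j)
    = gauss_int q (k + j + 1) * gauss_binomial q (2 * k + 1) (k - j) * gauss_binomial q (k + j) k"
proof -
  let ?c = "gauss_fact q k * gauss_fact q k * gauss_fact q (k - j) * gauss_fact q j"
  have 1: "gauss_binomial q (2 * k) k * gauss_fact q k * gauss_fact q k = gauss_fact q (2 * k)"
    using gauss_binomial_fact[of q k k] by (simp add: mult_2)
  have 2: "gauss_binomial q k (k - j) * gauss_fact q (k - j) * gauss_fact q j = gauss_fact q k"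
    using gauss_binomial_fact[of q "k - j" j] assms by simp
  have "(k - j) + Suc (k + j) = 2 * k + 1"
    using assms by simp
  \<comment> \<open>The last factor of \<open>[k+j+1]!\<close> is kept apart, since it has to
    survive as \<open>[k+j+1]\<close> on the right of the claim.\<close>
  then have 3: "gauss_binomial q (2 * k + 1) (k - j) * gauss_fact q (k - j)
      * (gauss_fact q (k + j) * gauss_int q (k + j + 1)) = gauss_fact q (2 * k) * gauss_int q (2 * k + 1)"
    using gauss_binomial_fact[of q "k - j" "Suc (k + j)"] by (simp add: gauss_fact_Suc mult_2)
  have "(gauss_int q (2 * k + 1) * gauss_binomial q (2 * k) k * gauss_binomial q k (k - j)) * ?c
      = gauss_int q (2 * k + 1)
        * (gauss_binomial q (2 * k) k * gauss_fact q k * gauss_fact q k)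
        * (gauss_binomial q k (k - j) * gauss_fact q (k - j) * gauss_fact q j)"
    by (simp only: mult_ac)
  also have "\<dots> = gauss_fact q (2 * k) * gauss_int q (2 * k + 1) * gauss_fact q k"
    unfolding 1 2 by (simp only: mult_ac)
  also have "\<dots> = gauss_binomial q (2 * k + 1) (k - j) * gauss_fact q (k - j)
      * ((gauss_binomial q (k + j) k * gauss_fact q k * gauss_fact q j) * gauss_int q (k + j + 1))
      * gauss_fact q k"
    unfolding 3[symmetric] gauss_binomial_fact ..
  also have "\<dots> = (gauss_int q (k + j + 1) * gauss_binomial q (2 * k + 1) (k - j)
      * gauss_binomial q (k + j) k) * ?c"
    by (simp only: mult_ac)
  finally show ?thesis
    unfolding mult_cancel_right using gauss_fact_nonzero by simp
qed

lemma gauss_int_dvd_sum_squares: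
  "gauss_int q n dvd gauss_int q (2 * k + 1) * gauss_binomial q (2 * k) k
     * (\<Sum>h<n. q ^ h * (gauss_binomial q h k)\<^sup>2)"
proof (cases n)
  case 0
  then show ?thesis by simp
next
  case n: (Suc n')
  let ?G = "gauss_binomial q"
  have "(\<Sum>h<n. q ^ h * (?G h k)\<^sup>2)
      = (\<Sum>h<n. \<Sum>j\<le>k. q ^ j\<^sup>2 * ?G k (k - j) * ?G (k + j) k * (q ^ h * ?G h (k + j)))"
    unfolding gauss_binomial_square by (simp add: sum_distrib_left mult_ac)
  also have "\<dots> = (\<Sum>j\<le>k. q ^ j\<^sup>2 * ?G k (k - j) * ?G (k + j) k * (\<Sum>h<n. q ^ h * ?G h (k + j)))"
    by (subst sum.swap) (simp add: sum_distrib_left)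
  also have "\<dots> = (\<Sum>j\<le>k. q ^ j\<^sup>2 * ?G k (k - j) * ?G (k + j) k * (q ^ (k + j) * ?G n (k + j + 1)))"
    by (simp add: sum_power_gauss_binomial)
  finally have sum: "(\<Sum>h<n. q ^ h * (?G h k)\<^sup>2)
      = (\<Sum>j\<le>k. q ^ j\<^sup>2 * ?G k (k - j) * ?G (k + j) k * (q ^ (k + j) * ?G n (k + j + 1)))" .
  \<comment> \<open>The divisibility already holds for each \<open>j\<close> separately.\<close>
  have "gauss_int q n dvd gauss_int q (2 * k + 1) * ?G (2 * k) k
      * (q ^ j\<^sup>2 * ?G k (k - j) * ?G (k + j) k * (q ^ (k + j) * ?G n (k + j + 1)))"
    if "j \<le> k" for j
  proof -
    have "gauss_int q (2 * k + 1) * ?G (2 * k) k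
        * (q ^ j\<^sup>2 * ?G k (k - j) * ?G (k + j) k * (q ^ (k + j) * ?G n (k + j + 1)))
      = (gauss_int q (2 * k + 1) * ?G (2 * k) k * ?G k (k - j))
        * (q ^ j\<^sup>2 * ?G (k + j) k * q ^ (k + j) * ?G n (k + j + 1))"
      by (simp only: mult_ac)
    also have "\<dots> = (gauss_int q (k + j + 1) * ?G n (k + j + 1))
        * (q ^ j\<^sup>2 * ?G (2 * k + 1) (k - j) * ?G (k + j) k * ?G (k + j) k * q ^ (k + j))"
      unfolding central_gauss_binomial_mult[OF that] by (simp only: mult_ac)
    \<comment> \<open>The \<open>[k+j+1]\<close> gained from the prefactor is traded for
      \<open>[n]\<close> by absorption; here \<open>n'\<close> is \<open>n - 1\<close>.\<close>
    also have "gauss_int q (k + j + 1) * ?G n (k + j + 1) = gauss_int q n * ?G n' (k + j)"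
      using gauss_binomial_absorption[of "k + j" n'] n by simp
    finally show ?thesis
      by (simp only: mult.assoc dvd_triv_left)
  qed
  then show ?thesis
    unfolding sum sum_distrib_left by (intro dvd_sum) auto
qed

end

section \<open>Transfer to the fraction field of the polynomial ring\<close>

lemma gauss_int_X_nonzero:
  assumes "n > 0"
  shows "gauss_int [:0, 1 :: int:] n \<noteq> 0"
proof -
  have "poly (gauss_int [:0, 1 :: int:] n) 1 = int n"
    by (simp add: gauss_int_def poly_sum)
  then show ?thesis
    using assms by auto
qed

lemma to_fract_power: "to_fract (x ^ n) = to_fract x ^ n"
  by (induction n) auto

lemma q_int_of_nat: "q_int (int n) = to_fract (gauss_int [:0, 1:] n)"
proof -
  \<comment> \<open>Field division by zero yields 0, so the geometric sum formula needs
    \<open>1 - qvar\<close> to be nonzero.\<close>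
  have "qvar \<noteq> 1"
    unfolding qvar_def to_fract_1[symmetric] to_fract_eq_iff by (simp add: one_pCons)
  then have "q_int (int n) = (\<Sum>i<n. qvar ^ i)"
    by (simp add: q_int_def sum_gp_strict)
  then show ?thesis
    by (induction n) (simp_all add: gauss_int_def qvar_def to_fract_power)
qed

text \<open>Raising \<open>k\<close> by one multiplies the quotient by \<open>[h-k] / [k+1]\<close>,
  which is \<open>gauss_binomial_step\<close> for the indeterminate.\<close>

lemma q_binomial_of_nat: "q_binomial (int h) k = to_fract (gauss_binomial [:0, 1:] h k)"
proof (induction k)
  case 0
  then show ?case by (simp add: q_binomial_def)
next
  case (Suc k)
  let ?X = "[:0, 1 :: int:]"
  have step: "q_binomial (int h) (Suc k)
      = q_binomial (int h) k * q_int (int h - int k) / q_int (int (Suc k))"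
    by (simp add: q_binomial_def)
  show ?case
  proof (cases "k \<le> h")
    case True
    then have "q_int (int h - int k) = to_fract (gauss_int ?X (h - k))"
      by (metis of_nat_diff q_int_of_nat)
    then have "q_binomial (int h) (Suc k)
        = to_fract (gauss_int ?X (h - k) * gauss_binomial ?X h k) / to_fract (gauss_int ?X (Suc k))"
      unfolding step Suc.IH q_int_of_nat by (simp add: mult_ac)
    also have "\<dots> = to_fract (gauss_binomial ?X h (Suc k))"
    proof -
      have "gauss_int ?X (h - k) * gauss_binomial ?X h k
          = gauss_int ?X (Suc k) * gauss_binomial ?X h (Suc k)"
        by (intro gauss_binomial_step[symmetric] gauss_int_X_nonzero True)
      then show ?thesis
        using gauss_int_X_nonzero[of "Suc k"] by simp
    qed
    finally show ?thesis .
  next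
    \<comment> \<open>Here \<open>q_int\<close> has a negative argument, but the induction
      hypothesis makes the other factor 0.\<close>
    case False
    then show ?thesis
      using Suc.IH unfolding step by (simp add: gauss_binomial_eq_0)
  qed
qed

lemma to_fract_sum: "to_fract (\<Sum>x\<in>A. f x) = (\<Sum>x\<in>A. to_fract (f x))"
  by (induction A rule: infinite_finite_induct) auto

theorem theorem3p1:
  fixes n k :: nat
  assumes "k < n"
  shows "Zq_cong
           (q_int (2 * int k + 1) * q_binomial (2 * int k) k *
              (\<Sum>h=0..n-1. qvar ^ h * (q_binomial (int h) k)\<^sup>2))
           0 (q_int (int n))
         \<and> [(2 * k + 1) * ((2 * k) choose k) * (\<Sum>h=0..n-1. (h choose k)\<^sup>2) = 0] (mod n)"
proof
  let ?X = "[:0, 1 :: int:]"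
  let ?P = "gauss_int ?X (2 * k + 1) * gauss_binomial ?X (2 * k) k
    * (\<Sum>h<n. ?X ^ h * (gauss_binomial ?X h k)\<^sup>2)"
  \<comment> \<open>This uses \<open>n > 0\<close>, which follows from \<open>k < n\<close>; for
    \<open>n = 0\<close> the left side would be \<open>{0}\<close>.\<close>
  have range: "{0..n-1} = {..<n}"
    using assms by auto
  have prefactors: "q_int (2 * int k + 1) = to_fract (gauss_int ?X (2 * k + 1))"
      "q_binomial (2 * int k) k = to_fract (gauss_binomial ?X (2 * k) k)"
    by (simp_all flip: q_int_of_nat q_binomial_of_nat add: add.commute)
  have P: "q_int (2 * int k + 1) * q_binomial (2 * int k) k *
      (\<Sum>h=0..n-1. qvar ^ h * (q_binomial (int h) k)\<^sup>2) = to_fract ?P"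
    unfolding range prefactors q_binomial_of_nat qvar_def
    by (simp only: to_fract_mult to_fract_sum to_fract_power)
  have "gauss_int ?X n dvd ?P"
    by (intro gauss_int_dvd_sum_squares gauss_int_X_nonzero)
  then obtain c where c: "?P = gauss_int ?X n * c" ..
  show "Zq_cong (q_int (2 * int k + 1) * q_binomial (2 * int k) k *
      (\<Sum>h=0..n-1. qvar ^ h * (q_binomial (int h) k)\<^sup>2)) 0 (q_int (int n))"
    unfolding Zq_cong_def Zq_def P q_int_of_nat
  proof (intro conjI)
    show "0 \<in> range to_fract"
      by (metis rangeI to_fract_0)
    show "\<exists>d\<in>range to_fract. to_fract ?P - 0 = to_fract (gauss_int ?X n) * d"
      unfolding c by auto
  qed (rule rangeI)+
  \<comment> \<open>The integer congruence is a second instance of the same divisibility, at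
    \<open>q = 1\<close>, rather than an evaluation of the polynomial cofactor.\<close>
  have "gauss_int (1 :: int) n dvd gauss_int 1 (2 * k + 1) * gauss_binomial 1 (2 * k) k
      * (\<Sum>h<n. 1 ^ h * (gauss_binomial 1 h k)\<^sup>2)"
    by (rule gauss_int_dvd_sum_squares) (simp add: gauss_int_1)
  then have "int n dvd int ((2 * k + 1) * ((2 * k) choose k) * (\<Sum>h<n. (h choose k)\<^sup>2))"
    by (simp add: gauss_int_1 gauss_binomial_1 algebra_simps)
  then show "[(2 * k + 1) * ((2 * k) choose k) * (\<Sum>h=0..n-1. (h choose k)\<^sup>2) = 0] (mod n)"
    unfolding range cong_0_iff int_dvd_int_iff .
qed

end
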